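(* Let $N\ge1$, let $\mathscr{A}\in\overline{\mathcal{H}}(N,N)$, and let $\tilde{\mathscr{A}}$ be a set of real $N\times N$ matrices satisfying $\mathscr{A}\subseteq\tilde{\mathscr{A}}\subseteq\operatorname{co}(\mathscr{A})$, where $\operatorname{co}(\mathscr{A})$ is the convex hull of $\mathscr{A}$. Then: (i) $\check{\rho}_{n}(\tilde{\mathscr{A}})=\rho_{\min}(\mathscr{A})$ for all $n\ge 1$, and therefore $\check{\rho}(\tilde{\mathscr{A}})=\rho_{\min}(\tilde{\mathscr{A}})=\rho_{\min}(\mathscr{A})$; (ii) $\hat{\rho}_{n}(\tilde{\mathscr{A}})=\rho_{\max}(\mathscr{A})$ for all $n\ge 1$, and therefore $\hat{\rho}(\tilde{\mathscr{A}})=\rho_{\max}(\tilde{\mathscr{A}})=\rho_{\max}(\mathscr{A})$.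
   Context: For vectors (or matrices) $x,y$ of the same size, $x\ge y$ (resp. $x>y$) means that every entry of $x$ is not less than (resp. strictly greater than) the corresponding entry of $y$; a matrix $A$ is positive if $A>0$. A set $\mathscr{A}$ of positive real $N\times M$ matrices is called an $\mathcal{H}$-set (hourglass set) if, whenever $\tilde{A}u=v$ for some $\tilde{A}\in\mathscr{A}$ and vectors $u\in\mathbb{R}^M$, $v\in\mathbb{R}^N$ with $u,v>0$, both of the following hold: H1: either $Au\ge v$ for all $A\in\mathscr{A}$, or there exists $\bar{A}\in\mathscr{A}$ such that $\bar{A}u\le v$ and $\bar{A}u\ne v$; H2: either $Au\le v$ for all $A\in\mathscr{A}$, or there exists $\bar{A}\in\mathscr{A}$ such that $\bar{A}u\ge v$ and $\bar{A}u\ne v$. $\mathcal{H}(N,M)$ denotes the collection of all nonempty compact $\mathcal{H}$-sets of positive real $N\times M$ matrices. Let $\mathcal{K}(N,M)$ be the collection of all nonempty compact sets of real $N\times M$ matrices, with the Hausdorff metric $$H(\mathscr{A},\mathscr{B})=\max\Bigl\{\sup_{A\in\mathscr{A}}\inf_{B\in\mathscr{B}}\|A-B\|,\ \sup_{B\in\mathscr{B}}\inf_{A\in\mathscr{A}}\|A-B\|\Bigr\}$$ for some fixed matrix norm. $\overline{\mathcal{H}}(N,M)$ denotes the closure of $\mathcal{H}(N,M)$ in $\mathcal{K}(N,M)$ in the Hausdorff metric. $\rho(A)$ denotes the spectral radius of a square matrix $A$. For a set $\mathscr{S}$ of $N\times N$ matrices and $n\ge1$: $$\rho_{\min}(\mathscr{S})=\min_{A\in\mathscr{S}}\rho(A),\quad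 \rho_{\max}(\mathscr{S})=\max_{A\in\mathscr{S}}\rho(A),$$ $$\hat{\rho}_{n}(\mathscr{S})=\sup_{A_1,\dots,A_n\in\mathscr{S}}\rho(A_n\cdots A_1)^{1/n},\quad \check{\rho}_{n}(\mathscr{S})=\inf_{A_1,\dots,A_n\in\mathscr{S}}\rho(A_n\cdots A_1)^{1/n}.$$ (For $\tilde{\mathscr{A}}$ the statement includes that the minimum and maximum defining $\rho_{\min}(\tilde{\mathscr{A}})$ and $\rho_{\max}(\tilde{\mathscr{A}})$ are attained.) The generalized spectral radius of a bounded set $\mathscr{S}$ is $\hat{\rho}(\mathscr{S})=\sup_{n\ge1}\hat{\rho}_n(\mathscr{S})$. The lower spectral radius is $\check{\rho}(\mathscr{S})=\inf_{n\ge1}\check{\rho}_n(\mathscr{S})$, which is known to equal $\lim_{n\to\infty}\inf_{A_i\in\mathscr{S}}\|A_n\cdots A_1\|^{1/n}$ for any operator norm. *)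

theory Defs
  imports "HOL-Analysis.Analysis"
begin

text \<open>A real \<open>N \<times> M\<close> matrix is an element of \<^typ>\<open>real^'m^'n\<close> with
  \<open>N = CARD('n)\<close> and \<open>M = CARD('m)\<close>.\<close>

text \<open>The library order \<open>\<le>\<close> on vectors is entrywise. The library \<open><\<close> on vectors only means
  \<open>\<le>\<close> and not \<open>\<ge>\<close>, so strict entrywise positivity is defined separately.\<close>

definition positive_vec :: "real^'m \<Rightarrow> bool" where
  "positive_vec u \<longleftrightarrow> (\<forall>i. 0 < u $ i)"

definition positive_mat :: "real^'m^'n \<Rightarrow> bool" where
  "positive_mat A \<longleftrightarrow> (\<forall>i j. 0 < A $ i $ j)"

definition hourglass_set :: "(real^'m^'n) set \<Rightarrow> bool" where
  "hourglass_set S \<longleftrightarrow>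
     (\<forall>A\<in>S. positive_mat A) \<and>
     (\<forall>At\<in>S. \<forall>u v. positive_vec u \<longrightarrow> positive_vec v \<longrightarrow> At *v u = v \<longrightarrow>
        ((\<forall>A\<in>S. v \<le> A *v u) \<or> (\<exists>B\<in>S. B *v u \<le> v \<and> B *v u \<noteq> v)) \<and>
        ((\<forall>A\<in>S. A *v u \<le> v) \<or> (\<exists>B\<in>S. v \<le> B *v u \<and> B *v u \<noteq> v)))"

definition compact_hourglass_sets :: "(real^'m^'n) set set" where
  "compact_hourglass_sets = {S. S \<noteq> {} \<and> compact S \<and> hourglass_set S}"

definition compact_mat_sets :: "(real^'m^'n) set set" where
  "compact_mat_sets = {S. S \<noteq> {} \<and> compact S}"

definition vector_norm :: "('a::real_vector \<Rightarrow> real) \<Rightarrow> bool" where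
  "vector_norm nu \<longleftrightarrow>
     (\<forall>x. nu x = 0 \<longrightarrow> x = 0) \<and>
     (\<forall>c x. nu (c *\<^sub>R x) = \<bar>c\<bar> * nu x) \<and>
     (\<forall>x y. nu (x + y) \<le> nu x + nu y)"

definition hausdorff_metric ::
    "('a::real_vector \<Rightarrow> real) \<Rightarrow> 'a set \<Rightarrow> 'a set \<Rightarrow> real" where
  "hausdorff_metric nu S T =
     max (SUP A\<in>S. INF B\<in>T. nu (A - B)) (SUP B\<in>T. INF A\<in>S. nu (A - B))"

text \<open>Closure of the compact hourglass sets in the space of nonempty compact sets of matrices
  with the Hausdorff metric induced by the norm \<open>nu\<close>.\<close>

definition closure_hourglass_sets :: "(real^'m^'n \<Rightarrow> real) \<Rightarrow> (real^'m^'n) set set" where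
  "closure_hourglass_sets nu =
     {S \<in> compact_mat_sets. \<forall>e>0. \<exists>T\<in>compact_hourglass_sets. hausdorff_metric nu S T < e}"

definition complex_eigenvalues :: "real^'n^'n \<Rightarrow> complex set" where
  "complex_eigenvalues A =
     {z. \<exists>x::complex^'n. x \<noteq> 0 \<and> map_matrix complex_of_real A *v x = z *s x}"

definition rho :: "real^'n^'n \<Rightarrow> real" where
  "rho A = Max (cmod ` complex_eigenvalues A)"

text \<open>These are the minimum and the maximum of \<^const>\<open>rho\<close> over \<open>S\<close> only if they are attained,
  that is, if they belong to \<open>rho ` S\<close>.\<close>

definition rho_min :: "(real^'n^'n) set \<Rightarrow> real" where
  "rho_min S = (INF A\<in>S. rho A)"

definition rho_max :: "(real^'n^'n) set \<Rightarrow> real" where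
  "rho_max S = (SUP A\<in>S. rho A)"

text \<open>\<open>mat_prod A n = A n ** \<dots> ** A 1\<close>; the entry \<open>A 0\<close> is not used.\<close>

primrec mat_prod :: "(nat \<Rightarrow> real^'n^'n) \<Rightarrow> nat \<Rightarrow> real^'n^'n" where
  "mat_prod A 0 = mat 1"
| "mat_prod A (Suc n) = A (Suc n) ** mat_prod A n"

definition rho_hat_n :: "nat \<Rightarrow> (real^'n^'n) set \<Rightarrow> real" where
  "rho_hat_n n S = (SUP A\<in>{A. \<forall>i\<in>{1..n}. A i \<in> S}. root n (rho (mat_prod A n)))"

definition rho_check_n :: "nat \<Rightarrow> (real^'n^'n) set \<Rightarrow> real" where
  "rho_check_n n S = (INF A\<in>{A. \<forall>i\<in>{1..n}. A i \<in> S}. root n (rho (mat_prod A n)))"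

definition generalized_spectral_radius :: "(real^'n^'n) set \<Rightarrow> real" where
  "generalized_spectral_radius S = (SUP n\<in>{1..}. rho_hat_n n S)"

definition lower_spectral_radius :: "(real^'n^'n) set \<Rightarrow> real" where
  "lower_spectral_radius S = (INF n\<in>{1..}. rho_check_n n S)"

end

theory Submission
  imports Defs
begin

text \<open>For a compact hourglass set, take a member \<open>A\<close> with the least Perron root \<open>r\<close> and its Perron
  vector \<open>v\<close>. If \<open>B v \<ge> r v\<close> failed for some member \<open>B\<close>, then H1 would give a member with
  \<open>B v \<le> r v\<close> and \<open>B v \<noteq> r v\<close>, whose Perron root is less than \<open>r\<close> by positivity. The inequality
  \<open>B v \<ge> r v\<close> passes to the convex hull and to products, which bounds the spectral radius of every
  product of \<open>n\<close> factors from below by \<open>r ^ n\<close>; \<open>A ^ n\<close> attains the bound. H2 gives the maximum in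
  the same way. For a limit of hourglass sets one passes to a convergent subsequence of these
  eigenpairs; the eigenvectors may lose positivity, and the upper bounds survive because the spectral
  radius of nonnegative matrices is lower semicontinuous.\<close>

section \<open>Nonnegative matrices and positive vectors\<close>

lemma nonneg_vec_iff: "0 \<le> (x :: real^'n) \<longleftrightarrow> (\<forall>i. 0 \<le> x $ i)"
  by (simp add: less_eq_vec_def)

lemma nonneg_mat_iff: "0 \<le> (A :: real^'m^'n) \<longleftrightarrow> (\<forall>i j. 0 \<le> A $ i $ j)"
  by (simp add: less_eq_vec_def)

lemma positive_vec_nonneg: "positive_vec x \<Longrightarrow> 0 \<le> x"
  by (simp add: positive_vec_def nonneg_vec_iff less_imp_le)

lemma positive_vec_nonzero: "positive_vec x \<Longrightarrow> x \<noteq> 0"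
  by (auto simp: positive_vec_def)

lemma positive_mat_nonneg: "positive_mat A \<Longrightarrow> 0 \<le> A"
  by (simp add: positive_mat_def nonneg_mat_iff less_imp_le)

lemma matrix_vector_mult_mono:
  fixes A B :: "real^'m^'n"
  assumes "0 \<le> A" "A \<le> B" "0 \<le> x" "x \<le> y"
  shows "A *v x \<le> B *v y"
  unfolding less_eq_vec_def matrix_vector_mult_def
proof (intro allI, simp, rule sum_mono)
  fix i j
  show "A $ i $ j * x $ j \<le> B $ i $ j * y $ j"
  proof (intro mult_mono)
    show "A $ i $ j \<le> B $ i $ j" "x $ j \<le> y $ j" "0 \<le> x $ j"
      using assms by (auto simp: less_eq_vec_def)
    have "0 \<le> B"
      using assms(1,2) by (rule order_trans)
    then show "0 \<le> B $ i $ j"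
      by (simp add: nonneg_mat_iff)
  qed
qed

lemma matrix_vector_mult_mono_right:
  fixes A :: "real^'m^'n"
  assumes "0 \<le> A" "x \<le> y"
  shows "A *v x \<le> A *v y"
  using assms unfolding less_eq_vec_def matrix_vector_mult_def
  by (auto intro!: sum_mono mult_left_mono)

lemma matrix_matrix_mult_nonneg:
  fixes A :: "real^'m^'n" and B :: "real^'k^'m"
  assumes "0 \<le> A" "0 \<le> B"
  shows "0 \<le> A ** B"
  using assms by (auto simp: nonneg_mat_iff matrix_matrix_mult_def intro!: sum_nonneg)

lemma positive_mat_mult_positive:
  fixes A :: "real^'m^'n"
  assumes "positive_mat A" "0 \<le> x" "x \<noteq> 0"
  shows "positive_vec (A *v x)"
  unfolding positive_vec_def
proof
  fix i
  obtain j where j: "x $ j \<noteq> 0"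
    using assms(3) by (auto simp: vec_eq_iff)
  have "0 < (\<Sum>j\<in>UNIV. A $ i $ j * x $ j)"
  proof (rule sum_pos2[of _ j])
    show "0 < A $ i $ j * x $ j"
      using assms(1,2) j by (simp add: positive_mat_def nonneg_vec_iff less_le)
    show "0 \<le> A $ i $ k * x $ k" for k
      using assms(1,2) by (simp add: positive_mat_def nonneg_vec_iff less_imp_le)
  qed auto
  then show "0 < (A *v x) $ i"
    by (simp add: matrix_vector_mult_def)
qed

lemma touching_multiple:
  fixes x w :: "real^'n"
  assumes x: "positive_vec x" and "0 \<le> w" "w \<noteq> 0"
  obtains c i where "0 < c" "w \<le> c *\<^sub>R x" "w $ i = c * x $ i"
proof -
  have xp: "0 < x $ i" for i
    using x by (simp add: positive_vec_def)
  define c where "c = Max (range (\<lambda>i. w $ i / x $ i))"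
  have "c \<in> range (\<lambda>i. w $ i / x $ i)"
    unfolding c_def by (rule Max_in) auto
  then obtain i where i: "c = w $ i / x $ i"
    by auto
  have le: "w $ j / x $ j \<le> c" for j
    unfolding c_def by (rule Max_ge) auto
  obtain k where k: "w $ k \<noteq> 0"
    using assms(3) by (auto simp: vec_eq_iff)
  then have "0 < w $ k"
    using assms(2) by (simp add: nonneg_vec_iff order.not_eq_order_implies_strict)
  then have "0 < w $ k / x $ k"
    using xp[of k] by simp
  then have "0 < c"
    using le[of k] by linarith
  moreover have "w \<le> c *\<^sub>R x"
    using le xp by (simp add: less_eq_vec_def divide_le_eq)
  moreover have "w $ i = c * x $ i"
    using i xp[of i] by simp
  ultimately show ?thesis
    using that by blast
qed

lemma subeigenvalue_le_supereigenvalue: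
  fixes P :: "real^'n^'n"
  assumes P: "0 \<le> P" and x: "positive_vec x" "P *v x \<le> r *\<^sub>R x"
    and w: "0 \<le> w" "w \<noteq> 0" "\<mu> *\<^sub>R w \<le> P *v w"
  shows "\<mu> \<le> r"
proof -
  obtain c i where c: "0 < c" "w \<le> c *\<^sub>R x" "w $ i = c * x $ i"
    using touching_multiple[OF x(1) w(1,2)] .
  have pos: "0 < w $ i"
    using c x(1) by (simp add: positive_vec_def)
  have "\<mu> * w $ i \<le> (P *v w) $ i"
    using w(3) by (simp add: less_eq_vec_def)
  also have "\<dots> \<le> (P *v (c *\<^sub>R x)) $ i"
    using matrix_vector_mult_mono_right[OF P c(2)] by (simp add: less_eq_vec_def)
  also have "\<dots> = c * (P *v x) $ i"
    by (simp add: matrix_vector_mult_scaleR)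
  also have "\<dots> \<le> c * (r * x $ i)"
    using x(2) c(1) by (simp add: less_eq_vec_def)
  also have "\<dots> = r * w $ i"
    using c(3) by simp
  finally show ?thesis
    using pos by simp
qed

lemma positive_mat_eigenvector_unique:
  fixes B :: "real^'n^'n"
  assumes B: "positive_mat B" and p: "positive_vec p" "B *v p \<le> s *\<^sub>R p"
    and q: "positive_vec q" "s *\<^sub>R q \<le> B *v q"
  obtains c where "0 < c" "q = c *\<^sub>R p"
proof -
  obtain c i where c: "0 < c" "q \<le> c *\<^sub>R p" "q $ i = c * p $ i"
    using touching_multiple[OF p(1) positive_vec_nonneg[OF q(1)] positive_vec_nonzero[OF q(1)]] .
  define d where "d = c *\<^sub>R p - q"
  have d: "0 \<le> d"
    using c(2) by (simp add: d_def)
  have "(B *v d) $ i = c * (B *v p) $ i - (B *v q) $ i"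
    by (simp add: d_def matrix_vector_mult_diff_distrib matrix_vector_mult_scaleR)
  also have "\<dots> \<le> c * (s * p $ i) - s * q $ i"
    using p(2) q(2) c(1) by (intro diff_mono mult_left_mono) (auto simp: less_eq_vec_def)
  also have "\<dots> = 0"
    using c(3) by simp
  finally have "\<not> positive_vec (B *v d)"
    by (auto simp: positive_vec_def not_less)
  then have "d = 0"
    using positive_mat_mult_positive[OF B d] by blast
  then show ?thesis
    using that[of c] c(1) by (simp add: d_def)
qed

lemma tendsto_matrix_vector_mult [tendsto_intros]:
  fixes A :: "'a \<Rightarrow> real^'m^'n"
  assumes "(A \<longlongrightarrow> L) F" "(x \<longlongrightarrow> y) F"
  shows "((\<lambda>k. A k *v x k) \<longlongrightarrow> L *v y) F"
  unfolding matrix_vector_mult_def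
  by (intro vec_tendstoI) (auto intro!: tendsto_intros assms)

lemma tendsto_matrix_matrix_mult [tendsto_intros]:
  fixes A :: "'a \<Rightarrow> real^'m^'n" and B :: "'a \<Rightarrow> real^'k^'m"
  assumes "(A \<longlongrightarrow> L) F" "(B \<longlongrightarrow> M) F"
  shows "((\<lambda>k. A k ** B k) \<longlongrightarrow> L ** M) F"
  unfolding matrix_matrix_mult_def
  by (intro vec_tendstoI) (auto intro!: tendsto_intros assms)

lemma convex_nonneg_mat_ge: "convex {C :: real^'n^'n. 0 \<le> C \<and> w \<le> C *v y}"
proof (rule convexI, safe)
  fix C D :: "real^'n^'n" and u t :: real
  assume *: "0 \<le> u" "0 \<le> t" "u + t = 1" "0 \<le> C" "0 \<le> D" "w \<le> C *v y" "w \<le> D *v y"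
  then show "0 \<le> u *\<^sub>R C + t *\<^sub>R D"
    by (simp add: nonneg_mat_iff)
  have "w = u *\<^sub>R w + t *\<^sub>R w"
    using *(3) by (simp flip: scaleR_left_distrib)
  also have "\<dots> \<le> u *\<^sub>R (C *v y) + t *\<^sub>R (D *v y)"
    using * by (intro add_mono scaleR_left_mono)
  finally show "w \<le> (u *\<^sub>R C + t *\<^sub>R D) *v y"
    by (simp add: matrix_vector_mult_add_rdistrib scaleR_matrix_vector_assoc)
qed

lemma convex_nonneg_mat_le: "convex {C :: real^'n^'n. 0 \<le> C \<and> C *v y \<le> w}"
proof (rule convexI, safe)
  fix C D :: "real^'n^'n" and u t :: real
  assume *: "0 \<le> u" "0 \<le> t" "u + t = 1" "0 \<le> C" "0 \<le> D" "C *v y \<le> w" "D *v y \<le> w"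
  then show "0 \<le> u *\<^sub>R C + t *\<^sub>R D"
    by (simp add: nonneg_mat_iff)
  have "u *\<^sub>R (C *v y) + t *\<^sub>R (D *v y) \<le> u *\<^sub>R w + t *\<^sub>R w"
    using * by (intro add_mono scaleR_left_mono)
  also have "\<dots> = w"
    using *(3) by (simp flip: scaleR_left_distrib)
  finally show "(u *\<^sub>R C + t *\<^sub>R D) *v y \<le> w"
    by (simp add: matrix_vector_mult_add_rdistrib scaleR_matrix_vector_assoc)
qed

lemma tendsto_vec_le:
  fixes X Y :: "'a \<Rightarrow> real^'n"
  assumes "F \<noteq> bot" "(X \<longlongrightarrow> x) F" "(Y \<longlongrightarrow> y) F" "\<And>k. X k \<le> Y k"
  shows "x \<le> y"
  unfolding less_eq_vec_def
proof
  fix i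
  show "x $ i \<le> y $ i"
    using assms(4)
    by (intro tendsto_le[OF assms(1) tendsto_vec_nth[OF assms(3)] tendsto_vec_nth[OF assms(2)]])
      (auto simp: less_eq_vec_def)
qed

text \<open>Since \<open>Q\<close> is nonnegative, \<open>t Q \<le> P k\<close> holds entrywise for every \<open>t < 1\<close> and all large \<open>k\<close>:
  this makes the spectral radius lower semicontinuous.\<close>

lemma subeigenvalue_le_limit:
  fixes P :: "nat \<Rightarrow> real^'n^'n"
  assumes lim: "P \<longlonglongrightarrow> Q" and nn: "\<And>k. 0 \<le> P k"
    and v: "\<And>k. positive_vec (v k)" "\<And>k. P k *v v k \<le> \<mu> k *\<^sub>R v k" and mu: "\<mu> \<longlonglongrightarrow> m"
    and w: "0 \<le> w" "w \<noteq> 0" "s *\<^sub>R w \<le> Q *v w"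
  shows "s \<le> m"
proof (rule field_le_mult_one_interval)
  fix t :: real
  assume t: "0 < t" "t < 1"
  have lim': "(\<lambda>k. P k $ i $ j) \<longlonglongrightarrow> Q $ i $ j" for i j
    by (intro tendsto_vec_nth lim)
  have Q: "0 \<le> Q $ i $ j" for i j
    using nn by (intro tendsto_lowerbound[OF lim']) (auto simp: nonneg_mat_iff)
  have "\<forall>\<^sub>F k in sequentially. t * Q $ i $ j \<le> P k $ i $ j" for i j
  proof (cases "Q $ i $ j = 0")
    case True
    then show ?thesis
      using nn by (auto simp: nonneg_mat_iff)
  next
    case False
    then have "t * Q $ i $ j < Q $ i $ j"
      using Q[of i j] t by simp
    from order_tendstoD(1)[OF lim' this] show ?thesis
      by (rule eventually_mono) simp
  qed
  then have "\<forall>\<^sub>F k in sequentially. \<forall>i j. t * Q $ i $ j \<le> P k $ i $ j"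
    by (intro eventually_all_finite)
  then have "\<forall>\<^sub>F k in sequentially. t * s \<le> \<mu> k"
  proof (rule eventually_mono)
    fix k
    assume "\<forall>i j. t * Q $ i $ j \<le> P k $ i $ j"
    then have le: "t *\<^sub>R Q \<le> P k"
      by (simp add: less_eq_vec_def)
    have "(t * s) *\<^sub>R w \<le> t *\<^sub>R (Q *v w)"
      using scaleR_left_mono[OF w(3), of t] t by simp
    also have "\<dots> = (t *\<^sub>R Q) *v w"
      by (simp add: scaleR_matrix_vector_assoc)
    also have "\<dots> \<le> P k *v w"
      using t Q by (intro matrix_vector_mult_mono[OF _ le w(1)]) (auto simp: nonneg_mat_iff)
    finally show "t * s \<le> \<mu> k"
      using subeigenvalue_le_supereigenvalue[OF nn v w(1,2)] by blast
  qed
  then show "t * s \<le> m"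
    by (intro tendsto_lowerbound[OF mu]) auto
qed

section \<open>Nonnegative eigenvectors\<close>

definition unit_simplex :: "(real^'n) set" where
  "unit_simplex = {x. 0 \<le> x \<and> (\<Sum>i\<in>UNIV. x $ i) = 1}"

lemma unit_simplex_nonneg: "x \<in> unit_simplex \<Longrightarrow> 0 \<le> x"
  by (simp add: unit_simplex_def)

lemma unit_simplex_nonzero: "x \<in> unit_simplex \<Longrightarrow> x \<noteq> 0"
  by (auto simp: unit_simplex_def)

lemma compact_unit_simplex: "compact (unit_simplex :: (real^'n) set)"
proof -
  have eq: "unit_simplex = (\<Inter>i. {x :: real^'n. 0 \<le> x $ i}) \<inter> {x. (\<Sum>i\<in>UNIV. x $ i) = 1}"
    by (auto simp: unit_simplex_def nonneg_vec_iff)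
  have "closed (unit_simplex :: (real^'n) set)"
    unfolding eq by (intro closed_Int closed_INT ballI closed_Collect_le closed_Collect_eq continuous_intros)
  moreover have "norm x \<le> 1" if "x \<in> unit_simplex" for x :: "real^'n"
    using norm_le_l1_cart[of x] that by (simp add: unit_simplex_def nonneg_vec_iff)
  ultimately show ?thesis
    by (auto simp: compact_eq_bounded_closed bounded_iff)
qed

lemma convex_unit_simplex: "convex (unit_simplex :: (real^'n) set)"
  unfolding unit_simplex_def convex_def
  by (auto simp: nonneg_vec_iff sum.distrib simp flip: sum_distrib_left)

lemma normalized_in_unit_simplex:
  fixes x :: "real^'n"
  assumes "0 \<le> x" "x \<noteq> 0"
  shows "(1 / (\<Sum>i\<in>UNIV. x $ i)) *\<^sub>R x \<in> unit_simplex" "0 < (\<Sum>i\<in>UNIV. x $ i)"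
proof -
  obtain j where "x $ j \<noteq> 0"
    using assms(2) by (auto simp: vec_eq_iff)
  then show pos: "0 < (\<Sum>i\<in>UNIV. x $ i)"
    using assms(1) by (intro sum_pos2[of _ j]) (auto simp: nonneg_vec_iff order.not_eq_order_implies_strict)
  then show "(1 / (\<Sum>i\<in>UNIV. x $ i)) *\<^sub>R x \<in> unit_simplex"
    using assms(1) by (auto simp: unit_simplex_def nonneg_vec_iff simp flip: sum_divide_distrib)
qed

lemma eigenvalue_eq_sum:
  fixes A :: "real^'n^'n"
  assumes "x \<in> unit_simplex" "A *v x = r *\<^sub>R x"
  shows "r = (\<Sum>i\<in>UNIV. (A *v x) $ i)"
  using assms by (simp add: unit_simplex_def flip: sum_distrib_left)

lemma positive_mat_eigenvector_positive:
  fixes A :: "real^'n^'n"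
  assumes A: "positive_mat A" and x: "x \<in> unit_simplex" "A *v x = r *\<^sub>R x"
  shows "positive_vec x" "0 < r"
proof -
  have p: "positive_vec (r *\<^sub>R x)"
    using positive_mat_mult_positive[OF A unit_simplex_nonneg unit_simplex_nonzero] x by metis
  then have "0 < r * x $ i" for i
    by (simp add: positive_vec_def)
  then show "positive_vec x" "0 < r"
    using unit_simplex_nonneg[OF x(1)] unfolding positive_vec_def nonneg_vec_iff
    by (metis zero_less_mult_iff order.strict_iff_not)+
qed

lemma positive_mat_has_eigenvector:
  fixes A :: "real^'n^'n"
  assumes A: "positive_mat A"
  obtains r x where "x \<in> unit_simplex" "A *v x = r *\<^sub>R x"
proof -
  define f where "f x = (1 / (\<Sum>i\<in>UNIV. (A *v x) $ i)) *\<^sub>R (A *v x)" for x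
  have pos: "positive_vec (A *v x)" if "x \<in> unit_simplex" for x
    using positive_mat_mult_positive[OF A unit_simplex_nonneg unit_simplex_nonzero] that by blast
  note nz = normalized_in_unit_simplex[OF positive_vec_nonneg positive_vec_nonzero, OF pos pos]
  have "continuous_on unit_simplex f"
    unfolding f_def using nz(2)
    by (intro continuous_intros linear_continuous_on_compose[OF continuous_on_id]) force+
  moreover have "f \<in> unit_simplex \<rightarrow> unit_simplex"
    using nz(1) by (auto simp: f_def)
  moreover have "(unit_simplex :: (real^'n) set) \<noteq> {}"
    using normalized_in_unit_simplex(1)[of 1] by (force simp: nonneg_vec_iff vec_eq_iff)
  ultimately obtain x where x: "x \<in> unit_simplex" "f x = x"
    using brouwer[OF compact_unit_simplex convex_unit_simplex] by metis
  have "A *v x = (\<Sum>i\<in>UNIV. (A *v x) $ i) *\<^sub>R f x"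
    using nz(2)[OF x(1) x(1)] by (simp add: f_def)
  then show ?thesis
    using that x by metis
qed

lemma eigenpair_subsequence:
  fixes A A' :: "nat \<Rightarrow> real^'n^'n"
  assumes S: "compact S" and A': "\<And>k. A' k \<in> S" and d: "(\<lambda>k. A k - A' k) \<longlonglongrightarrow> 0"
    and x: "\<And>k. x k \<in> unit_simplex" "\<And>k. A k *v x k = r k *\<^sub>R x k"
  obtains f B y s where "strict_mono f" "B \<in> S" "y \<in> unit_simplex" "(\<lambda>k. A (f k)) \<longlonglongrightarrow> B"
    "(\<lambda>k. x (f k)) \<longlonglongrightarrow> y" "(\<lambda>k. r (f k)) \<longlonglongrightarrow> s" "B *v y = s *\<^sub>R y"
proof -
  have "seq_compact (S \<times> (unit_simplex :: (real^'n) set))"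
    by (intro compact_imp_seq_compact compact_Times S compact_unit_simplex)
  moreover have "\<forall>k. (A' k, x k) \<in> S \<times> unit_simplex"
    using A' x by simp
  ultimately obtain l f where l: "l \<in> S \<times> unit_simplex" "strict_mono f"
      "((\<lambda>k. (A' k, x k)) \<circ> f) \<longlonglongrightarrow> l"
    by (rule seq_compactE)
  define B y where "B = fst l" and "y = snd l"
  define s where "s = (\<Sum>i\<in>UNIV. (B *v y) $ i)"
  have By: "B \<in> S" "y \<in> unit_simplex"
    using l(1) by (auto simp: B_def y_def)
  have limA': "(\<lambda>k. A' (f k)) \<longlonglongrightarrow> B"
    using tendsto_fst[OF l(3)] by (simp add: B_def o_def)
  have limx: "(\<lambda>k. x (f k)) \<longlonglongrightarrow> y"
    using tendsto_snd[OF l(3)] by (simp add: y_def o_def)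
  have "(\<lambda>k. A (f k) - A' (f k)) \<longlonglongrightarrow> 0"
    using LIMSEQ_subseq_LIMSEQ[OF d l(2)] by (simp add: o_def)
  from tendsto_add[OF this limA'] have limA: "(\<lambda>k. A (f k)) \<longlonglongrightarrow> B"
    by simp
  have "(\<lambda>k. \<Sum>i\<in>UNIV. (A (f k) *v x (f k)) $ i) \<longlonglongrightarrow> s"
    unfolding s_def by (intro tendsto_intros limA limx)
  moreover have "(\<Sum>i\<in>UNIV. (A (f k) *v x (f k)) $ i) = r (f k)" for k
    using eigenvalue_eq_sum[OF x(1,2)] by simp
  ultimately have limr: "(\<lambda>k. r (f k)) \<longlonglongrightarrow> s"
    by simp
  have "(\<lambda>k. A (f k) *v x (f k)) \<longlonglongrightarrow> s *\<^sub>R y"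
    unfolding x(2) by (intro tendsto_intros limr limx)
  moreover have "(\<lambda>k. A (f k) *v x (f k)) \<longlonglongrightarrow> B *v y"
    by (intro tendsto_intros limA limx)
  ultimately have "B *v y = s *\<^sub>R y"
    using LIMSEQ_unique by blast
  then show ?thesis
    using that l(2) By limA limx limr by blast
qed

lemma nonneg_mat_eigenvalue_ge:
  fixes P :: "real^'n^'n"
  assumes P: "0 \<le> P" and v: "0 \<le> v" "v \<noteq> 0" "\<mu> *\<^sub>R v \<le> P *v v"
  obtains r x where "\<mu> \<le> r" "x \<in> unit_simplex" "P *v x = r *\<^sub>R x"
proof -
  define E :: "nat \<Rightarrow> real^'n^'n" where "E k = (\<chi> i j. inverse (real (Suc k)))" for k
  have Epos: "0 < E k $ i $ j" for k and i j :: 'n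
    by (simp add: E_def)
  have pos: "positive_mat (P + E k)" for k
    using P Epos by (auto simp: positive_mat_def nonneg_mat_iff intro: add_nonneg_pos)
  have "\<forall>k. \<exists>x r. x \<in> unit_simplex \<and> (P + E k) *v x = r *\<^sub>R x"
    using positive_mat_has_eigenvector[OF pos] by metis
  then obtain x r where x: "\<And>k. x k \<in> unit_simplex" "\<And>k. (P + E k) *v x k = r k *\<^sub>R x k"
    by metis
  have "E \<longlonglongrightarrow> (\<chi> i j. 0)"
    unfolding E_def by (intro vec_tendstoI) (use LIMSEQ_inverse_real_of_nat in simp)
  then have lim: "(\<lambda>k. (P + E k) - P) \<longlonglongrightarrow> 0"
    by (simp add: zero_vec_def)
  obtain f y s where *: "y \<in> unit_simplex" "(\<lambda>k. r (f k)) \<longlonglongrightarrow> s" "P *v y = s *\<^sub>R y"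
    by (rule eigenpair_subsequence[of "{P}" "\<lambda>_. P", OF _ _ lim x]) auto
  have "\<mu> \<le> r k" for k
  proof (rule subeigenvalue_le_supereigenvalue[OF positive_mat_nonneg[OF pos] _ _ v(1,2)])
    show "positive_vec (x k)"
      using positive_mat_eigenvector_positive[OF pos] x by blast
    show "(P + E k) *v x k \<le> r k *\<^sub>R x k"
      using x by simp
    have "P *v v \<le> (P + E k) *v v"
      using Epos by (intro matrix_vector_mult_mono P v(1)) (auto simp: less_eq_vec_def less_imp_le)
    then show "\<mu> *\<^sub>R v \<le> (P + E k) *v v"
      using v(3) by (rule order_trans[rotated])
  qed
  then have "\<mu> \<le> s"
    by (intro tendsto_lowerbound[OF *(2)]) auto
  then show ?thesis
    using that * by blast
qed

section \<open>The spectral radius\<close>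

lemma cmod_eigenvector:
  fixes A :: "real^'n^'n"
  assumes "z \<in> complex_eigenvalues A"
  obtains w where "0 \<le> w" "w \<noteq> 0" "cmod z *\<^sub>R w \<le> (\<chi> i j. \<bar>A $ i $ j\<bar>) *v w"
proof -
  obtain x where x: "x \<noteq> 0" "map_matrix complex_of_real A *v x = z *s x"
    using assms by (auto simp: complex_eigenvalues_def)
  define w where "w = (\<chi> i. cmod (x $ i))"
  have "cmod z * cmod (x $ i) \<le> (\<Sum>j\<in>UNIV. \<bar>A $ i $ j\<bar> * cmod (x $ j))" for i
  proof -
    have "z * x $ i = (\<Sum>j\<in>UNIV. complex_of_real (A $ i $ j) * x $ j)"
      using x(2) by (simp add: vec_eq_iff matrix_vector_mult_def map_matrix_def)
    then have "cmod z * cmod (x $ i) = cmod (\<Sum>j\<in>UNIV. complex_of_real (A $ i $ j) * x $ j)"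
      by (metis norm_mult)
    also have "\<dots> \<le> (\<Sum>j\<in>UNIV. cmod (complex_of_real (A $ i $ j) * x $ j))"
      by (rule norm_sum)
    finally show ?thesis
      by (simp add: norm_mult)
  qed
  then have "cmod z *\<^sub>R w \<le> (\<chi> i j. \<bar>A $ i $ j\<bar>) *v w"
    by (simp add: less_eq_vec_def w_def matrix_vector_mult_def)
  moreover have "0 \<le> w" "w \<noteq> 0"
    using x(1) by (auto simp: w_def nonneg_vec_iff vec_eq_iff)
  ultimately show ?thesis
    using that by blast
qed

lemma bounded_complex_eigenvalues:
  fixes A :: "real^'n^'n"
  shows "bounded (complex_eigenvalues A)"
  unfolding bounded_iff
proof (intro exI ballI)
  fix z
  assume "z \<in> complex_eigenvalues A"
  then obtain w where w: "0 \<le> w" "w \<noteq> 0" "cmod z *\<^sub>R w \<le> (\<chi> i j. \<bar>A $ i $ j\<bar>) *v w"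
    using cmod_eigenvector by blast
  have "(\<chi> i j. \<bar>A $ i $ j\<bar>) *v 1 \<le> (\<Sum>i\<in>UNIV. \<Sum>j\<in>UNIV. \<bar>A $ i $ j\<bar>) *\<^sub>R 1"
    by (auto simp: less_eq_vec_def matrix_vector_mult_def sum_nonneg
        intro!: member_le_sum[where f = "\<lambda>i. \<Sum>j\<in>UNIV. \<bar>A $ i $ j\<bar>"])
  then show "cmod z \<le> (\<Sum>i\<in>UNIV. \<Sum>j\<in>UNIV. \<bar>A $ i $ j\<bar>)"
    by (rule subeigenvalue_le_supereigenvalue[OF _ _ _ w, rotated 2])
      (auto simp: nonneg_mat_iff positive_vec_def)
qed

lemma complex_eigenvalues_iff_det:
  fixes A :: "real^'n^'n"
  shows "z \<in> complex_eigenvalues A \<longleftrightarrow> det (map_matrix complex_of_real A - mat z) = 0"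
proof -
  have "mat z *v x = z *s x" for x :: "complex^'n"
    by (simp add: vec_eq_iff matrix_vector_mult_def mat_def if_distrib[where f = "\<lambda>a. a * _"] cong: if_cong)
  then have "z \<in> complex_eigenvalues A \<longleftrightarrow>
      (\<exists>x. x \<noteq> 0 \<and> (map_matrix complex_of_real A - mat z) *v x = 0)"
    by (simp add: complex_eigenvalues_def matrix_vector_mult_diff_rdistrib)
  also have "\<dots> \<longleftrightarrow> \<not> invertible (map_matrix complex_of_real A - mat z)"
    by (metis invertible_left_inverse matrix_left_invertible_ker)
  finally show ?thesis
    by (simp add: invertible_det_nz)
qed

lemma finite_complex_eigenvalues:
  fixes A :: "real^'n^'n"
  shows "finite (complex_eigenvalues A)"
proof -
  define p where "p = det (\<chi> i j. [:complex_of_real (A $ i $ j), if i = j then -1 else 0:])"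
  have "poly p z = det (map_matrix complex_of_real A - mat z)" for z
    by (simp add: p_def det_def poly_sum poly_prod map_matrix_def mat_def)
      (auto intro!: sum.cong prod.cong)
  then have eq: "complex_eigenvalues A = {z. poly p z = 0}"
    by (auto simp: complex_eigenvalues_iff_det)
  have "p \<noteq> 0"
  proof
    assume "p = 0"
    then have "bounded (UNIV :: complex set)"
      using bounded_complex_eigenvalues[of A] eq by simp
    then show False
      using not_bounded_UNIV by blast
  qed
  then show ?thesis
    using poly_roots_finite eq by simp
qed

lemma real_eigenvalue_in_complex_eigenvalues:
  fixes A :: "real^'n^'n"
  assumes "x \<noteq> 0" "A *v x = r *\<^sub>R x"
  shows "complex_of_real r \<in> complex_eigenvalues A"
proof -
  define y where "y = (\<chi> i. complex_of_real (x $ i))"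
  have "map_matrix complex_of_real A *v y = (\<chi> i. complex_of_real ((A *v x) $ i))"
    by (simp add: y_def vec_eq_iff matrix_vector_mult_def map_matrix_def)
  also have "\<dots> = complex_of_real r *s y"
    using assms(2) by (simp add: y_def vec_eq_iff)
  finally have "map_matrix complex_of_real A *v y = complex_of_real r *s y" .
  moreover have "y \<noteq> 0"
    using assms(1) by (auto simp: y_def vec_eq_iff)
  ultimately show ?thesis
    unfolding complex_eigenvalues_def by blast
qed

lemma real_eigenvalue_le_rho:
  fixes A :: "real^'n^'n"
  assumes "x \<noteq> 0" "A *v x = r *\<^sub>R x"
  shows "\<bar>r\<bar> \<le> rho A"
proof -
  have "cmod (complex_of_real r) \<le> rho A"
    unfolding rho_def using finite_complex_eigenvalues real_eigenvalue_in_complex_eigenvalues[OF assms]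
    by (intro Max_ge finite_imageI imageI)
  then show ?thesis
    by simp
qed

lemma subeigenvalue_le_rho:
  fixes P :: "real^'n^'n"
  assumes "0 \<le> P" "0 \<le> v" "v \<noteq> 0" "\<mu> *\<^sub>R v \<le> P *v v"
  shows "\<mu> \<le> rho P"
proof -
  obtain r x where "\<mu> \<le> r" "x \<in> unit_simplex" "P *v x = r *\<^sub>R x"
    using nonneg_mat_eigenvalue_ge[OF assms] .
  then show ?thesis
    using real_eigenvalue_le_rho[of x P r] unit_simplex_nonzero by force
qed

lemma rho_subeigenvector:
  fixes P :: "real^'n^'n"
  assumes P: "0 \<le> P"
  obtains w where "0 \<le> w" "w \<noteq> 0" "rho P *\<^sub>R w \<le> P *v w"
proof -
  have "0 *\<^sub>R 1 \<le> P *v (1 :: real^'n)"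
    using matrix_vector_mult_mono_right[OF P, of 0 1] by (simp add: less_eq_vec_def)
  then obtain r x where x: "x \<in> unit_simplex" "P *v x = r *\<^sub>R x"
    using nonneg_mat_eigenvalue_ge[OF P _ _ \<open>0 *\<^sub>R 1 \<le> P *v 1\<close>]
    by (metis nonneg_vec_iff one_index zero_index zero_le_one zero_neq_one)
  then have "complex_eigenvalues P \<noteq> {}"
    using real_eigenvalue_in_complex_eigenvalues unit_simplex_nonzero by blast
  then have "rho P \<in> cmod ` complex_eigenvalues P"
    unfolding rho_def using finite_complex_eigenvalues by (intro Max_in) auto
  then obtain z where z: "z \<in> complex_eigenvalues P" "rho P = cmod z"
    by blast
  have "(\<chi> i j. \<bar>P $ i $ j\<bar>) = P"
    using P by (simp add: vec_eq_iff nonneg_mat_iff)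
  then show ?thesis
    using cmod_eigenvector[OF z(1)] that z(2) by metis
qed

lemma rho_le_limit:
  fixes P :: "nat \<Rightarrow> real^'n^'n"
  assumes "P \<longlonglongrightarrow> Q" "\<And>k. 0 \<le> P k" "\<And>k. positive_vec (v k)"
    "\<And>k. P k *v v k \<le> \<mu> k *\<^sub>R v k" "\<mu> \<longlonglongrightarrow> m"
  shows "rho Q \<le> m"
proof -
  have "0 \<le> Q $ i $ j" for i j
    using assms(2)
    by (intro tendsto_lowerbound[OF tendsto_vec_nth[OF tendsto_vec_nth[OF assms(1)]]])
      (auto simp: nonneg_mat_iff)
  then have "0 \<le> Q"
    by (simp add: nonneg_mat_iff)
  then obtain w where "0 \<le> w" "w \<noteq> 0" "rho Q *\<^sub>R w \<le> Q *v w"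
    using rho_subeigenvector by blast
  then show ?thesis
    using subeigenvalue_le_limit[OF assms] by blast
qed

section \<open>Products of matrices\<close>

lemma mat_prod_nonneg: "(\<And>i. i \<in> {1..n} \<Longrightarrow> 0 \<le> A i) \<Longrightarrow> 0 \<le> mat_prod A n"
proof (induction n)
  case 0
  show ?case
    by (simp add: nonneg_mat_iff mat_def)
qed (auto intro!: matrix_matrix_mult_nonneg)

lemma mat_prod_subeigenvector:
  assumes "\<And>i. i \<in> {1..n} \<Longrightarrow> 0 \<le> A i \<and> r *\<^sub>R v \<le> A i *v v" "0 \<le> r"
  shows "r ^ n *\<^sub>R v \<le> mat_prod A n *v v"
  using assms
proof (induction n)
  case (Suc n)
  have "r ^ Suc n *\<^sub>R v = r ^ n *\<^sub>R (r *\<^sub>R v)"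
    by (simp add: mult.commute)
  also have "\<dots> \<le> r ^ n *\<^sub>R (A (Suc n) *v v)"
    using Suc.prems by (intro scaleR_left_mono) auto
  also have "\<dots> = A (Suc n) *v (r ^ n *\<^sub>R v)"
    by (simp add: matrix_vector_mult_scaleR)
  also have "\<dots> \<le> A (Suc n) *v (mat_prod A n *v v)"
    using Suc by (intro matrix_vector_mult_mono_right) auto
  finally show ?case
    by (simp add: matrix_vector_mul_assoc)
qed simp

lemma mat_prod_supereigenvector:
  assumes "\<And>i. i \<in> {1..n} \<Longrightarrow> 0 \<le> A i \<and> A i *v v \<le> r *\<^sub>R v" "0 \<le> r"
  shows "mat_prod A n *v v \<le> r ^ n *\<^sub>R v"
  using assms
proof (induction n)
  case (Suc n)
  have "mat_prod A (Suc n) *v v = A (Suc n) *v (mat_prod A n *v v)"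
    by (simp add: matrix_vector_mul_assoc)
  also have "\<dots> \<le> A (Suc n) *v (r ^ n *\<^sub>R v)"
    using Suc by (intro matrix_vector_mult_mono_right) auto
  also have "\<dots> = r ^ n *\<^sub>R (A (Suc n) *v v)"
    by (simp add: matrix_vector_mult_scaleR)
  also have "\<dots> \<le> r ^ n *\<^sub>R (r *\<^sub>R v)"
    using Suc.prems by (intro scaleR_left_mono) auto
  finally show ?case
    by (simp add: mult.commute)
qed simp

lemma tendsto_mat_prod:
  assumes "\<And>i. i \<in> {1..n} \<Longrightarrow> ((\<lambda>k. X k i) \<longlongrightarrow> A i) F"
  shows "((\<lambda>k. mat_prod (X k) n) \<longlongrightarrow> mat_prod A n) F"
  using assms by (induction n) (auto intro!: tendsto_intros)

section \<open>Extremal eigenpairs of hourglass sets\<close>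

lemma continuous_on_matrix_vector_mult [continuous_intros]:
  fixes f :: "'a::topological_space \<Rightarrow> real^'m^'n"
  assumes "continuous_on S f" "continuous_on S g"
  shows "continuous_on S (\<lambda>x. f x *v g x)"
  using assms by (auto simp: continuous_on_def intro!: tendsto_intros)

lemma eigenvalue_extrema_attained:
  fixes S :: "(real^'n^'n) set"
  assumes "S \<in> compact_hourglass_sets"
  shows "\<exists>A\<in>S. \<exists>v\<in>unit_simplex. \<exists>r. A *v v = r *\<^sub>R v \<and>
      (\<forall>B\<in>S. \<forall>y\<in>unit_simplex. \<forall>s. B *v y = s *\<^sub>R y \<longrightarrow> r \<le> s)" (is ?min)
    and "\<exists>A\<in>S. \<exists>v\<in>unit_simplex. \<exists>r. A *v v = r *\<^sub>R v \<and>
      (\<forall>B\<in>S. \<forall>y\<in>unit_simplex. \<forall>s. B *v y = s *\<^sub>R y \<longrightarrow> s \<le> r)" (is ?max)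
proof -
  define e where "e p = (\<Sum>i\<in>UNIV. (fst p *v snd p) $ i)" for p :: "(real^'n^'n) \<times> (real^'n)"
  define E where "E = {p \<in> S \<times> unit_simplex. fst p *v snd p = e p *\<^sub>R snd p}"
  have e: "continuous_on T e" for T
    unfolding e_def by (intro continuous_intros)
  have "E = (S \<times> unit_simplex) \<inter> {p. fst p *v snd p = e p *\<^sub>R snd p}"
    by (auto simp: E_def)
  moreover have "closed {p. fst p *v snd p = e p *\<^sub>R snd p}"
    by (intro closed_Collect_eq continuous_intros e)
  ultimately have "compact E"
    using assms by (auto simp: compact_hourglass_sets_def compact_unit_simplex intro!: compact_Int_closed compact_Times)
  moreover have "E \<noteq> {}"
  proof -
    obtain A where A: "A \<in> S" "positive_mat A"
      using assms by (auto simp: compact_hourglass_sets_def hourglass_set_def)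
    then obtain r x where "x \<in> unit_simplex" "A *v x = r *\<^sub>R x"
      using positive_mat_has_eigenvector by blast
    then have "(A, x) \<in> E"
      using A eigenvalue_eq_sum[of x A r] by (simp add: E_def e_def)
    then show ?thesis
      by blast
  qed
  moreover have mem: "(B, y) \<in> E \<and> e (B, y) = s"
    if "B \<in> S" "y \<in> unit_simplex" "B *v y = s *\<^sub>R y" for B y s
    using that eigenvalue_eq_sum[OF that(2,3)] by (simp add: E_def e_def)
  ultimately obtain p q where p: "p \<in> E" "\<And>p'. p' \<in> E \<Longrightarrow> e p \<le> e p'"
    and q: "q \<in> E" "\<And>p'. p' \<in> E \<Longrightarrow> e p' \<le> e q"
    using continuous_attains_inf[OF _ _ e] continuous_attains_sup[OF _ _ e] by metis
  show ?min
  proof (intro bexI exI conjI ballI allI impI)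
    show "fst p *v snd p = e p *\<^sub>R snd p" "fst p \<in> S" "snd p \<in> unit_simplex"
      using p(1) by (auto simp: E_def)
    show "e p \<le> s" if "B \<in> S" "y \<in> unit_simplex" "B *v y = s *\<^sub>R y" for B y s
      using mem[OF that] p(2) by blast
  qed
  show ?max
  proof (intro bexI exI conjI ballI allI impI)
    show "fst q *v snd q = e q *\<^sub>R snd q" "fst q \<in> S" "snd q \<in> unit_simplex"
      using q(1) by (auto simp: E_def)
    show "s \<le> e q" if "B \<in> S" "y \<in> unit_simplex" "B *v y = s *\<^sub>R y" for B y s
      using mem[OF that] q(2) by blast
  qed
qed

lemma compact_hourglass_setsD:
  assumes "S \<in> compact_hourglass_sets" "A \<in> S" "positive_vec u" "positive_vec (A *v u)"
  shows "(\<forall>B\<in>S. A *v u \<le> B *v u) \<or> (\<exists>B\<in>S. B *v u \<le> A *v u \<and> B *v u \<noteq> A *v u)"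
    and "(\<forall>B\<in>S. B *v u \<le> A *v u) \<or> (\<exists>B\<in>S. A *v u \<le> B *v u \<and> B *v u \<noteq> A *v u)"
proof -
  have "hourglass_set S"
    using assms(1) by (simp add: compact_hourglass_sets_def)
  then show "(\<forall>B\<in>S. A *v u \<le> B *v u) \<or> (\<exists>B\<in>S. B *v u \<le> A *v u \<and> B *v u \<noteq> A *v u)"
    and "(\<forall>B\<in>S. B *v u \<le> A *v u) \<or> (\<exists>B\<in>S. A *v u \<le> B *v u \<and> B *v u \<noteq> A *v u)"
    using assms(2-4) unfolding hourglass_set_def by blast+
qed

lemma hourglass_min_eigenpair:
  fixes S :: "(real^'n^'n) set"
  assumes S: "S \<in> compact_hourglass_sets"
  obtains A v r where "A \<in> S" "v \<in> unit_simplex" "positive_vec v" "A *v v = r *\<^sub>R v"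
    "\<And>B. B \<in> S \<Longrightarrow> r *\<^sub>R v \<le> B *v v"
proof -
  obtain A v r where A: "A \<in> S" "v \<in> unit_simplex" "A *v v = r *\<^sub>R v"
    and min: "\<And>B y s. B \<in> S \<Longrightarrow> y \<in> unit_simplex \<Longrightarrow> B *v y = s *\<^sub>R y \<Longrightarrow> r \<le> s"
    using eigenvalue_extrema_attained(1)[OF S] by blast
  have pos: "positive_mat B" if "B \<in> S" for B
    using S that by (simp add: compact_hourglass_sets_def hourglass_set_def)
  have v: "positive_vec v" "0 < r"
    using positive_mat_eigenvector_positive[OF pos A(2,3)] A(1) by auto
  then have "positive_vec (r *\<^sub>R v)"
    by (simp add: positive_vec_def)
  then have "(\<forall>B\<in>S. r *\<^sub>R v \<le> B *v v) \<or> (\<exists>B\<in>S. B *v v \<le> r *\<^sub>R v \<and> B *v v \<noteq> r *\<^sub>R v)"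
    using compact_hourglass_setsD(1)[OF S A(1) v(1)] A(3) by simp
  moreover have False if B: "B \<in> S" "B *v v \<le> r *\<^sub>R v" "B *v v \<noteq> r *\<^sub>R v" for B
  proof -
    obtain s y where y: "y \<in> unit_simplex" "B *v y = s *\<^sub>R y"
      using positive_mat_has_eigenvector[OF pos[OF B(1)]] .
    have "r \<le> s"
      using min B(1) y by blast
    then have le: "r *\<^sub>R v \<le> s *\<^sub>R v"
      using positive_vec_nonneg[OF v(1)] by (rule scaleR_right_mono)
    obtain c where "0 < c" "y = c *\<^sub>R v"
      using positive_mat_eigenvector_unique[OF pos[OF B(1)] v(1) order_trans[OF B(2) le]
          positive_mat_eigenvector_positive(1)[OF pos[OF B(1)] y]] y(2) by auto
    then have "c *\<^sub>R (B *v v) = c *\<^sub>R (s *\<^sub>R v)"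
      using y(2) by (simp add: matrix_vector_mult_scaleR mult.commute)
    then have "B *v v = s *\<^sub>R v"
      using \<open>0 < c\<close> scaleR_cancel_left by (metis less_irrefl)
    then show False
      using B(2,3) le by simp
  qed
  ultimately show ?thesis
    using that A v(1) by blast
qed

lemma hourglass_max_eigenpair:
  fixes S :: "(real^'n^'n) set"
  assumes S: "S \<in> compact_hourglass_sets"
  obtains A v r where "A \<in> S" "v \<in> unit_simplex" "positive_vec v" "A *v v = r *\<^sub>R v"
    "\<And>B. B \<in> S \<Longrightarrow> B *v v \<le> r *\<^sub>R v"
proof -
  obtain A v r where A: "A \<in> S" "v \<in> unit_simplex" "A *v v = r *\<^sub>R v"
    and max: "\<And>B y s. B \<in> S \<Longrightarrow> y \<in> unit_simplex \<Longrightarrow> B *v y = s *\<^sub>R y \<Longrightarrow> s \<le> r"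
    using eigenvalue_extrema_attained(2)[OF S] by blast
  have pos: "positive_mat B" if "B \<in> S" for B
    using S that by (simp add: compact_hourglass_sets_def hourglass_set_def)
  have v: "positive_vec v" "0 < r"
    using positive_mat_eigenvector_positive[OF pos A(2,3)] A(1) by auto
  then have "positive_vec (r *\<^sub>R v)"
    by (simp add: positive_vec_def)
  then have "(\<forall>B\<in>S. B *v v \<le> r *\<^sub>R v) \<or> (\<exists>B\<in>S. r *\<^sub>R v \<le> B *v v \<and> B *v v \<noteq> r *\<^sub>R v)"
    using compact_hourglass_setsD(2)[OF S A(1) v(1)] A(3) by simp
  moreover have False if B: "B \<in> S" "r *\<^sub>R v \<le> B *v v" "B *v v \<noteq> r *\<^sub>R v" for B
  proof -
    obtain s y where y: "y \<in> unit_simplex" "B *v y = s *\<^sub>R y"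
      using positive_mat_has_eigenvector[OF pos[OF B(1)]] .
    have "s \<le> r"
      using max B(1) y by blast
    then have le: "s *\<^sub>R v \<le> r *\<^sub>R v"
      using positive_vec_nonneg[OF v(1)] by (rule scaleR_right_mono)
    obtain c where "0 < c" "v = c *\<^sub>R y"
      using positive_mat_eigenvector_unique[OF pos[OF B(1)]
          positive_mat_eigenvector_positive(1)[OF pos[OF B(1)] y] _ v(1) order_trans[OF le B(2)]] y(2)
      by auto
    then have "B *v v = s *\<^sub>R v"
      using y(2) by (simp add: matrix_vector_mult_scaleR)
    then show False
      using B(2,3) le by simp
  qed
  ultimately show ?thesis
    using that A v(1) by blast
qed

section \<open>Convergence in the Hausdorff metric\<close>

lemma vector_norm_nonneg:
  assumes "vector_norm nu"
  shows "0 \<le> nu x"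
proof -
  have "nu 0 = 0"
    using assms unfolding vector_norm_def by (metis abs_zero mult_zero_left scaleR_zero_left)
  moreover have "nu (- x) = nu x"
    using assms unfolding vector_norm_def
    by (metis abs_minus_cancel abs_one mult_1 scaleR_minus1_left)
  moreover have "nu (x + - x) \<le> nu x + nu (- x)"
    using assms unfolding vector_norm_def by blast
  ultimately show ?thesis
    by simp
qed

lemma vector_norm_equivalent:
  fixes nu :: "'a::euclidean_space \<Rightarrow> real"
  assumes nu: "vector_norm nu"
  obtains m C where "0 < m" "\<And>x. m * norm x \<le> nu x" "\<And>x. nu x \<le> C * norm x"
proof -
  have zero: "nu x = 0 \<Longrightarrow> x = 0" and scale: "nu (c *\<^sub>R x) = \<bar>c\<bar> * nu x"
    and tri: "nu (x + y) \<le> nu x + nu y" for c x y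
    using nu by (auto simp: vector_norm_def)
  have sum: "nu (sum f B) \<le> (\<Sum>b\<in>B. nu (f b))" if "finite B" for f and B :: "'a set"
    using that
  proof (induction B rule: finite_induct)
    case empty
    show ?case
      using scale[of 0 0] by simp
  next
    case (insert b B)
    then show ?case
      using tri[of "f b" "sum f B"] by simp
  qed
  define C where "C = (\<Sum>b\<in>Basis. nu b)"
  have upper: "nu x \<le> C * norm x" for x
  proof -
    have "nu x = nu (\<Sum>b\<in>Basis. (x \<bullet> b) *\<^sub>R b)"
      by (simp add: euclidean_representation)
    also have "\<dots> \<le> (\<Sum>b\<in>Basis. \<bar>x \<bullet> b\<bar> * nu b)"
      using sum[OF finite_Basis, of "\<lambda>b. (x \<bullet> b) *\<^sub>R b"] by (simp add: scale)
    also have "\<dots> \<le> (\<Sum>b\<in>Basis. norm x * nu b)"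
      by (intro sum_mono mult_right_mono Basis_le_norm vector_norm_nonneg[OF nu])
    finally show ?thesis
      by (simp add: C_def sum_distrib_left mult.commute)
  qed
  have diff: "nu x - nu y \<le> nu (x - y)" for x y
    using tri[of "x - y" y] by simp
  have sym: "nu (x - y) = nu (y - x)" for x y
    using scale[of "-1" "x - y"] by simp
  have "C-lipschitz_on (sphere 0 1) nu"
  proof (rule lipschitz_onI)
    show "dist (nu x) (nu y) \<le> C * dist x y" for x y
      using upper[of "x - y"] diff[of x y] diff[of y x] sym[of x y] by (simp add: dist_norm abs_le_iff)
    show "0 \<le> C"
      by (auto simp: C_def intro!: sum_nonneg vector_norm_nonneg[OF nu])
  qed
  then have "continuous_on (sphere 0 1) nu"
    by (rule lipschitz_on_continuous_on)
  moreover have "sphere (0::'a) 1 \<noteq> {}"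
    by simp
  ultimately obtain x0 where x0: "x0 \<in> sphere 0 1" "\<And>x. x \<in> sphere 0 1 \<Longrightarrow> nu x0 \<le> nu x"
    using continuous_attains_inf[OF compact_sphere] by metis
  show ?thesis
  proof
    have "nu x0 \<noteq> 0"
      using x0(1) zero by force
    then show "0 < nu x0"
      using vector_norm_nonneg[OF nu, of x0] by simp
    show "nu x0 * norm x \<le> nu x" for x
    proof (cases "x = 0")
      case False
      then have "nu x0 \<le> nu ((1 / norm x) *\<^sub>R x)"
        by (intro x0(2)) simp
      then show ?thesis
        using False by (simp add: scale field_simps)
    qed (use vector_norm_nonneg[OF nu] in simp)
    show "nu x \<le> C * norm x" for x
      by (rule upper)
  qed
qed

lemma SUP_INF_less_imp_near:
  fixes nu :: "'a::euclidean_space \<Rightarrow> real"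
  assumes nu: "vector_norm nu" and "bounded S" "T \<noteq> {}"
    and less: "(SUP x\<in>S. INF y\<in>T. nu (x - y)) < e" and x: "x \<in> S"
  obtains y where "y \<in> T" "nu (x - y) < e"
proof -
  obtain C where C: "\<And>x. nu x \<le> C * norm x"
    using vector_norm_equivalent[OF nu] by metis
  obtain t where t: "t \<in> T"
    using assms(3) by blast
  have bdd: "bdd_below ((\<lambda>y. nu (z - y)) ` T)" for z
    by (intro bdd_belowI2[of _ 0] vector_norm_nonneg[OF nu])
  have "bounded ((\<lambda>z. z - t) ` S)"
    using bounded_translation_minus[OF assms(2)] by simp
  then obtain K where K: "\<And>z. z \<in> S \<Longrightarrow> norm (z - t) \<le> K"
    by (auto simp: bounded_iff)
  have "(INF y\<in>T. nu (z - y)) \<le> \<bar>C\<bar> * K" if "z \<in> S" for z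
  proof -
    have "(INF y\<in>T. nu (z - y)) \<le> nu (z - t)"
      by (rule cINF_lower[OF bdd t])
    also have "\<dots> \<le> \<bar>C\<bar> * norm (z - t)"
      using C[of "z - t"] by (rule order_trans) (simp add: mult_right_mono)
    also have "\<dots> \<le> \<bar>C\<bar> * K"
      using K[OF that] by (simp add: mult_left_mono)
    finally show ?thesis .
  qed
  then have "bdd_above ((\<lambda>z. INF y\<in>T. nu (z - y)) ` S)"
    by (rule bdd_aboveI2)
  then have "(INF y\<in>T. nu (x - y)) < e"
    using less cSUP_upper[OF x] by (meson le_less_trans)
  then show ?thesis
    using that by (auto simp: cINF_less_iff[OF assms(3) bdd])
qed

lemma hausdorff_metric_commute:
  assumes "vector_norm nu"
  shows "hausdorff_metric nu S T = hausdorff_metric nu T S"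
proof -
  have "nu (x - y) = nu (y - x)" for x y
    using assms unfolding vector_norm_def
    by (metis abs_minus_cancel abs_one minus_diff_eq mult_1 scaleR_minus1_left)
  then show ?thesis
    by (simp add: hausdorff_metric_def max.commute)
qed

lemma hausdorff_metric_less_imp_near:
  fixes nu :: "'a::euclidean_space \<Rightarrow> real"
  assumes "vector_norm nu" "bounded S" "T \<noteq> {}" "hausdorff_metric nu S T < e" "x \<in> S"
  obtains y where "y \<in> T" "nu (x - y) < e"
  using SUP_INF_less_imp_near[OF assms(1-3) _ assms(5), of e] assms(4)
  by (auto simp: hausdorff_metric_def)

locale hourglass_approximation =
  fixes S :: "(real^'n^'n) set" and T :: "nat \<Rightarrow> (real^'n^'n) set"
  assumes compact: "compact S"
    and hourglass: "\<And>k. T k \<in> compact_hourglass_sets"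
    and approximates: "\<And>A k. A \<in> S \<Longrightarrow> \<exists>B\<in>T k. norm (B - A) < inverse (real (Suc k))"
    and near: "\<And>B k. B \<in> T k \<Longrightarrow> \<exists>A\<in>S. norm (B - A) < inverse (real (Suc k))"
begin

lemma nonneg_hull_approximation:
  assumes "B \<in> convex hull T k"
  shows "0 \<le> B"
proof -
  have "convex hull T k \<subseteq> {B. 0 \<le> B}"
  proof (rule hull_minimal)
    show "T k \<subseteq> {B. 0 \<le> B}"
      using hourglass[of k] positive_mat_nonneg by (auto simp: compact_hourglass_sets_def hourglass_set_def)
    show "convex {B :: real^'n^'n. 0 \<le> B}"
      by (auto simp: convex_def nonneg_mat_iff)
  qed
  then show ?thesis
    using assms by blast
qed

lemma approximating_sequence:
  assumes "A \<in> S"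
  shows "\<exists>X. (\<forall>k. X k \<in> T k) \<and> X \<longlonglongrightarrow> A"
proof -
  obtain X where X: "\<And>k. X k \<in> T k" "\<And>k. norm (X k - A) < inverse (real (Suc k))"
    using approximates[OF assms] by metis
  have "(\<lambda>k. X k - A) \<longlonglongrightarrow> 0"
    by (rule LIMSEQ_norm_0) (use X(2) in \<open>simp add: inverse_eq_divide\<close>)
  then have "X \<longlonglongrightarrow> A"
    by (rule LIM_zero_cancel)
  then show ?thesis
    using X(1) by blast
qed

lemma hull_approximating_sequence:
  assumes "A \<in> convex hull S"
  shows "\<exists>X. (\<forall>k. X k \<in> convex hull T k) \<and> X \<longlonglongrightarrow> A"
proof -
  define L where "L = {A. \<exists>X. (\<forall>k. X k \<in> convex hull T k) \<and> X \<longlonglongrightarrow> A}"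
  have "convex hull S \<subseteq> L"
  proof (rule hull_minimal)
    show "S \<subseteq> L"
    proof
      fix A
      assume A: "A \<in> S"
      obtain X where "\<And>k. X k \<in> T k" "X \<longlonglongrightarrow> A"
        using approximating_sequence[OF A] by blast
      then show "A \<in> L"
        unfolding L_def by (auto intro: hull_inc)
    qed
    show "convex L"
    proof (rule convexI)
      fix A B and u v :: real
      assume "A \<in> L" "B \<in> L" and uv: "0 \<le> u" "0 \<le> v" "u + v = 1"
      then obtain X Y where XY: "\<And>k. X k \<in> convex hull T k" "X \<longlonglongrightarrow> A"
          "\<And>k. Y k \<in> convex hull T k" "Y \<longlonglongrightarrow> B"
        by (auto simp: L_def)
      have "(\<lambda>k. u *\<^sub>R X k + v *\<^sub>R Y k) \<longlonglongrightarrow> u *\<^sub>R A + v *\<^sub>R B"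
        by (intro tendsto_intros XY)
      moreover have "u *\<^sub>R X k + v *\<^sub>R Y k \<in> convex hull T k" for k
        by (intro convexD[OF convex_convex_hull] XY uv)
      ultimately show "u *\<^sub>R A + v *\<^sub>R B \<in> L"
        unfolding L_def by (intro CollectI exI[of _ "\<lambda>k. u *\<^sub>R X k + v *\<^sub>R Y k"]) simp
    qed
  qed
  then show ?thesis
    using assms by (auto simp: L_def)
qed

lemma eigenpair_limit:
  assumes "\<And>k. A k \<in> T k" "\<And>k. x k \<in> unit_simplex" "\<And>k. A k *v x k = r k *\<^sub>R x k"
  obtains f B y s where "strict_mono f" "B \<in> S" "y \<in> unit_simplex" "(\<lambda>k. A (f k)) \<longlonglongrightarrow> B"
    "(\<lambda>k. x (f k)) \<longlonglongrightarrow> y" "(\<lambda>k. r (f k)) \<longlonglongrightarrow> s" "B *v y = s *\<^sub>R y" "0 \<le> s"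
proof -
  have "\<forall>k. \<exists>C. C \<in> S \<and> norm (A k - C) < inverse (real (Suc k))"
    using near[OF assms(1)] by blast
  then obtain A' where A': "\<And>k. A' k \<in> S" "\<And>k. norm (A k - A' k) < inverse (real (Suc k))"
    by metis
  have d: "(\<lambda>k. A k - A' k) \<longlonglongrightarrow> 0"
    by (rule LIMSEQ_norm_0) (use A'(2) in \<open>simp add: inverse_eq_divide\<close>)
  obtain f B y s where *: "strict_mono f" "B \<in> S" "y \<in> unit_simplex" "(\<lambda>k. A (f k)) \<longlonglongrightarrow> B"
    "(\<lambda>k. x (f k)) \<longlonglongrightarrow> y" "(\<lambda>k. r (f k)) \<longlonglongrightarrow> s" "B *v y = s *\<^sub>R y"
    using eigenpair_subsequence[OF compact A'(1) d assms(2,3)] by blast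
  have "positive_mat (A k)" for k
    using hourglass[of k] assms(1) by (auto simp: compact_hourglass_sets_def hourglass_set_def)
  then have "0 < r k" for k
    using positive_mat_eigenvector_positive(2) assms(2,3) by blast
  then have "0 \<le> s"
    by (intro tendsto_lowerbound[OF *(6)]) (auto simp: less_imp_le)
  then show ?thesis
    using that * by blast
qed

lemma nonneg:
  assumes "A \<in> S"
  shows "0 \<le> A"
proof -
  obtain X where X: "\<And>k. X k \<in> T k" "X \<longlonglongrightarrow> A"
    using approximating_sequence[OF assms] by blast
  have "0 \<le> X k" for k
    using nonneg_hull_approximation hull_inc X(1) by metis
  then have "0 \<le> A $ i $ j" for i j
    by (intro tendsto_lowerbound[OF tendsto_vec_nth[OF tendsto_vec_nth[OF X(2)]]])
      (auto simp: nonneg_mat_iff)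
  then show ?thesis
    by (simp add: nonneg_mat_iff)
qed

lemma rho_power:
  assumes "\<And>k. A k \<in> T k" "\<And>k. positive_vec (x k)" "\<And>k. A k *v x k = r k *\<^sub>R x k"
    and "A \<longlonglongrightarrow> B" "r \<longlonglongrightarrow> s" and B: "B \<in> S" "y \<in> unit_simplex" "B *v y = s *\<^sub>R y" "0 \<le> s"
  shows "rho (mat_prod (\<lambda>_. B) n) = s ^ n"
proof (rule antisym)
  have pos: "positive_mat (A k)" for k
    using hourglass[of k] assms(1) by (auto simp: compact_hourglass_sets_def hourglass_set_def)
  have r: "0 \<le> r k" for k
  proof -
    have "positive_vec (r k *\<^sub>R x k)"
      using positive_mat_mult_positive[OF pos positive_vec_nonneg positive_vec_nonzero] assms(2,3)
      by metis
    then have "0 < r k * x k $ i" "0 < x k $ i" for i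
      using assms(2)[of k] by (auto simp: positive_vec_def)
    then show ?thesis
      by (meson less_imp_le zero_less_mult_pos2)
  qed
  show "rho (mat_prod (\<lambda>_. B) n) \<le> s ^ n"
  proof (rule rho_le_limit)
    show "(\<lambda>k. mat_prod (\<lambda>_. A k) n) \<longlonglongrightarrow> mat_prod (\<lambda>_. B) n"
      by (intro tendsto_mat_prod assms)
    show "(\<lambda>k. r k ^ n) \<longlonglongrightarrow> s ^ n"
      by (intro tendsto_intros assms)
    show "0 \<le> mat_prod (\<lambda>_. A k) n" for k
      by (intro mat_prod_nonneg positive_mat_nonneg pos)
    show "mat_prod (\<lambda>_. A k) n *v x k \<le> r k ^ n *\<^sub>R x k" for k
      using r positive_mat_nonneg[OF pos] assms(3) by (intro mat_prod_supereigenvector) auto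
  qed (rule assms)
  show "s ^ n \<le> rho (mat_prod (\<lambda>_. B) n)"
    using nonneg B unit_simplex_nonneg unit_simplex_nonzero
    by (intro subeigenvalue_le_rho[of _ y] mat_prod_nonneg mat_prod_subeigenvector) auto
qed

lemma subsequence:
  assumes f: "strict_mono f"
  shows "hourglass_approximation S (\<lambda>k. T (f k))"
proof
  have le: "inverse (real (Suc (f k))) \<le> inverse (real (Suc k))" for k
    using strict_mono_imp_increasing[OF f, of k] by (intro le_imp_inverse_le) auto
  show "\<exists>B\<in>T (f k). norm (B - A) < inverse (real (Suc k))" if "A \<in> S" for A k
    using approximates[OF that, of "f k"] le[of k] by (meson less_le_trans)
  show "\<exists>A\<in>S. norm (B - A) < inverse (real (Suc k))" if "B \<in> T (f k)" for B k
    using near[OF that] le[of k] by (meson less_le_trans)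
qed (rule compact hourglass)+

lemma minimal_products:
  "\<exists>A\<in>S. \<exists>s\<ge>0. (\<forall>n. rho (mat_prod (\<lambda>_. A) n) = s ^ n) \<and>
    (\<forall>Q n. (\<forall>i\<in>{1..n}. Q i \<in> convex hull S) \<longrightarrow> s ^ n \<le> rho (mat_prod Q n))"
proof -
  have "\<forall>k. \<exists>A v r. A \<in> T k \<and> v \<in> unit_simplex \<and> positive_vec v \<and> A *v v = r *\<^sub>R v \<and>
      (\<forall>B\<in>T k. r *\<^sub>R v \<le> B *v v)"
    using hourglass_min_eigenpair[OF hourglass] by metis
  then obtain A v r where A: "\<And>k. A k \<in> T k" "\<And>k. v k \<in> unit_simplex" "\<And>k. A k *v v k = r k *\<^sub>R v k"
    and pos: "\<And>k. positive_vec (v k)" and le: "\<And>k B. B \<in> T k \<Longrightarrow> r k *\<^sub>R v k \<le> B *v v k"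
    by metis
  obtain f B y s where f: "strict_mono f" and By: "B \<in> S" "y \<in> unit_simplex"
    and lim: "(\<lambda>k. A (f k)) \<longlonglongrightarrow> B" "(\<lambda>k. v (f k)) \<longlonglongrightarrow> y" "(\<lambda>k. r (f k)) \<longlonglongrightarrow> s"
    and s: "B *v y = s *\<^sub>R y" "0 \<le> s"
    using eigenpair_limit[OF A] .
  note B = By s
  interpret sub: hourglass_approximation S "\<lambda>k. T (f k)"
    by (rule subsequence[OF f])
  have rho: "rho (mat_prod (\<lambda>_. B) n) = s ^ n" for n
    using sub.rho_power[OF A(1) pos A(3) lim(1,3) B] .
  have "s *\<^sub>R y \<le> C *v y" if C: "C \<in> S" for C
  proof -
    obtain X where X: "\<And>k. X k \<in> T (f k)" "X \<longlonglongrightarrow> C"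
      using sub.approximating_sequence[OF C] by blast
    show ?thesis
    proof (rule tendsto_vec_le)
      show "(\<lambda>k. r (f k) *\<^sub>R v (f k)) \<longlonglongrightarrow> s *\<^sub>R y"
        by (intro tendsto_intros lim)
      show "(\<lambda>k. X k *v v (f k)) \<longlonglongrightarrow> C *v y"
        by (intro tendsto_intros lim X)
    qed (use le X in auto)
  qed
  then have "convex hull S \<subseteq> {C. 0 \<le> C \<and> s *\<^sub>R y \<le> C *v y}"
    using nonneg by (intro hull_minimal convex_nonneg_mat_ge) auto
  then have hull: "0 \<le> C \<and> s *\<^sub>R y \<le> C *v y" if "C \<in> convex hull S" for C
    using that by blast
  have "s ^ n \<le> rho (mat_prod Q n)" if "\<And>i. i \<in> {1..n} \<Longrightarrow> Q i \<in> convex hull S" for Q n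
    using hull that B(2,4) unit_simplex_nonneg unit_simplex_nonzero
    by (intro subeigenvalue_le_rho[of _ y] mat_prod_nonneg mat_prod_subeigenvector) blast+
  then show ?thesis
    using B(1,4) rho by blast
qed

text \<open>Here the limit vector \<open>y\<close> may have zero entries, so that \<open>Q y \<le> s y\<close> would not bound
  \<open>rho Q\<close>. The bound is taken before passing to the limit, where the eigenvectors are positive.\<close>

lemma maximal_products:
  "\<exists>A\<in>S. \<exists>s\<ge>0. (\<forall>n. rho (mat_prod (\<lambda>_. A) n) = s ^ n) \<and>
    (\<forall>Q n. (\<forall>i\<in>{1..n}. Q i \<in> convex hull S) \<longrightarrow> rho (mat_prod Q n) \<le> s ^ n)"
proof -
  have "\<forall>k. \<exists>A v r. A \<in> T k \<and> v \<in> unit_simplex \<and> positive_vec v \<and> A *v v = r *\<^sub>R v \<and>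
      (\<forall>B\<in>T k. B *v v \<le> r *\<^sub>R v)"
    using hourglass_max_eigenpair[OF hourglass] by metis
  then obtain A v r where A: "\<And>k. A k \<in> T k" "\<And>k. v k \<in> unit_simplex" "\<And>k. A k *v v k = r k *\<^sub>R v k"
    and pos: "\<And>k. positive_vec (v k)" and le: "\<And>k B. B \<in> T k \<Longrightarrow> B *v v k \<le> r k *\<^sub>R v k"
    by metis
  obtain f B y s where f: "strict_mono f" and By: "B \<in> S" "y \<in> unit_simplex"
    and lim: "(\<lambda>k. A (f k)) \<longlonglongrightarrow> B" "(\<lambda>k. v (f k)) \<longlonglongrightarrow> y" "(\<lambda>k. r (f k)) \<longlonglongrightarrow> s"
    and s: "B *v y = s *\<^sub>R y" "0 \<le> s"
    using eigenpair_limit[OF A] .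
  note B = By s
  interpret sub: hourglass_approximation S "\<lambda>k. T (f k)"
    by (rule subsequence[OF f])
  have rho: "rho (mat_prod (\<lambda>_. B) n) = s ^ n" for n
    using sub.rho_power[OF A(1) pos A(3) lim(1,3) B] .
  have posT: "positive_mat C" if "C \<in> T k" for C k
    using hourglass[of k] that by (auto simp: compact_hourglass_sets_def hourglass_set_def)
  have r: "0 \<le> r k" for k
    using positive_mat_eigenvector_positive(2)[OF posT[OF A(1)] A(2,3)] by (rule less_imp_le)
  have "convex hull T k \<subseteq> {C. 0 \<le> C \<and> C *v v k \<le> r k *\<^sub>R v k}" for k
    using posT positive_mat_nonneg le by (intro hull_minimal convex_nonneg_mat_le) auto
  then have hull: "0 \<le> C \<and> C *v v k \<le> r k *\<^sub>R v k" if "C \<in> convex hull T k" for C k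
    using that by blast
  have "rho (mat_prod Q n) \<le> s ^ n" if Q: "\<And>i. i \<in> {1..n} \<Longrightarrow> Q i \<in> convex hull S" for Q n
  proof -
    have "\<exists>X. (\<forall>k. X k \<in> convex hull T (f k)) \<and> X \<longlonglongrightarrow> Q i" if "i \<in> {1..n}" for i
      using sub.hull_approximating_sequence[OF Q[OF that]] .
    then obtain X where X: "\<And>i k. i \<in> {1..n} \<Longrightarrow> X i k \<in> convex hull T (f k)"
        "\<And>i. i \<in> {1..n} \<Longrightarrow> X i \<longlonglongrightarrow> Q i"
      by metis
    show ?thesis
    proof (rule rho_le_limit)
      show "(\<lambda>k. mat_prod (\<lambda>i. X i k) n) \<longlonglongrightarrow> mat_prod Q n"
        by (intro tendsto_mat_prod) (use X in simp)
      show "(\<lambda>k. r (f k) ^ n) \<longlonglongrightarrow> s ^ n"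
        by (intro tendsto_intros lim)
      show "0 \<le> mat_prod (\<lambda>i. X i k) n" for k
        using X hull by (intro mat_prod_nonneg) blast
      show "mat_prod (\<lambda>i. X i k) n *v v (f k) \<le> r (f k) ^ n *\<^sub>R v (f k)" for k
        using X hull r by (intro mat_prod_supereigenvector) blast+
    qed (rule pos)
  qed
  then show ?thesis
    using B(1,4) rho by blast
qed

end

lemma closure_hourglass_sets_approximation:
  fixes nu :: "real^'n^'n \<Rightarrow> real"
  assumes nu: "vector_norm nu" and S: "S \<in> closure_hourglass_sets nu"
  obtains T where "hourglass_approximation S T"
proof -
  obtain m where m: "0 < m" "\<And>x. m * norm x \<le> nu x"
    using vector_norm_equivalent[OF nu] by metis
  have "\<forall>k. \<exists>T\<in>compact_hourglass_sets. hausdorff_metric nu S T < m * inverse (real (Suc k))"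
    using S m(1) unfolding closure_hourglass_sets_def by simp
  then obtain T where T: "\<And>k. T k \<in> compact_hourglass_sets"
      "\<And>k. hausdorff_metric nu S (T k) < m * inverse (real (Suc k))"
    by metis
  have compact: "compact S" "S \<noteq> {}" "compact (T k)" "T k \<noteq> {}" for k
    using S T(1)[of k] by (auto simp: closure_hourglass_sets_def compact_mat_sets_def compact_hourglass_sets_def)
  have norm: "norm x < e" if "nu x < m * e" for x e
    using m that by (meson le_less_trans mult_less_cancel_left_pos)
  show ?thesis
  proof (rule that, unfold_locales)
    fix k
    show "\<exists>B\<in>T k. norm (B - A) < inverse (real (Suc k))" if "A \<in> S" for A
      using hausdorff_metric_less_imp_near[OF nu compact_imp_bounded[OF compact(1)] compact(4) T(2) that]
        norm by (metis norm_minus_commute)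
    show "\<exists>A\<in>S. norm (B - A) < inverse (real (Suc k))" if "B \<in> T k" for B
      using hausdorff_metric_less_imp_near[OF nu compact_imp_bounded[OF compact(3)] compact(2) _ that]
        T(2) hausdorff_metric_commute[OF nu] norm by metis
  qed (rule compact T)+
qed

theorem theorem3:
  fixes nu :: "real^'n^'n \<Rightarrow> real"
    and S St :: "(real^'n^'n) set"
  assumes "vector_norm nu"
    and "S \<in> closure_hourglass_sets nu"
    and "S \<subseteq> St" and "St \<subseteq> convex hull S"
  shows
    "(rho_min S \<in> rho ` S \<and> rho_min St \<in> rho ` St \<and>
      (\<forall>n\<ge>1. rho_check_n n St = rho_min S) \<and>
      lower_spectral_radius St = rho_min St \<and> rho_min St = rho_min S) \<and>
     (rho_max S \<in> rho ` S \<and> rho_max St \<in> rho ` St \<and>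
      (\<forall>n\<ge>1. rho_hat_n n St = rho_max S) \<and>
      generalized_spectral_radius St = rho_max St \<and> rho_max St = rho_max S)"
proof -
  obtain T where "hourglass_approximation S T"
    using closure_hourglass_sets_approximation[OF assms(1,2)] .
  then interpret hourglass_approximation S T .
  obtain A a where A: "A \<in> S" "0 \<le> a" "\<And>n. rho (mat_prod (\<lambda>_. A) n) = a ^ n"
    and min: "\<And>Q n. (\<And>i. i \<in> {1..n} \<Longrightarrow> Q i \<in> convex hull S) \<Longrightarrow> a ^ n \<le> rho (mat_prod Q n)"
    using minimal_products by metis
  obtain B b where B: "B \<in> S" "0 \<le> b" "\<And>n. rho (mat_prod (\<lambda>_. B) n) = b ^ n"
    and max: "\<And>Q n. (\<And>i. i \<in> {1..n} \<Longrightarrow> Q i \<in> convex hull S) \<Longrightarrow> rho (mat_prod Q n) \<le> b ^ n"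
    using maximal_products by metis
  have rhoA: "rho A = a" and rhoB: "rho B = b"
    using A(3)[of 1] B(3)[of 1] by simp_all
  have rho_bounds: "a \<le> rho C" "rho C \<le> b" if "C \<in> convex hull S" for C
    using min[of 1 "\<lambda>_. C"] max[of 1 "\<lambda>_. C"] that by simp_all
  have rho_min: "rho_min R = a" and rho_max: "rho_max R = b" if "S \<subseteq> R" "R \<subseteq> convex hull S" for R
    unfolding rho_min_def rho_max_def using A(1) B(1) rhoA rhoB rho_bounds that
    by (auto intro!: cInf_eq_minimum cSup_eq_maximum)
  have "rho_min S = a" "rho_max S = b"
    by (intro rho_min rho_max hull_subset order_refl)+
  moreover have "rho_min St = a" "rho_max St = b"
    by (intro rho_min rho_max assms)+
  moreover have check: "rho_check_n n St = a" if "n \<ge> 1" for n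
    unfolding rho_check_n_def
  proof (rule cInf_eq_minimum)
    have "root n (rho (mat_prod (\<lambda>_. A) n)) = a"
      using A that by (simp add: real_root_power_cancel)
    then show "a \<in> (\<lambda>Q. root n (rho (mat_prod Q n))) ` {Q. \<forall>i\<in>{1..n}. Q i \<in> St}"
      using A(1) assms(3) by (intro rev_image_eqI[of "\<lambda>_. A"]) auto
    fix x
    assume "x \<in> (\<lambda>Q. root n (rho (mat_prod Q n))) ` {Q. \<forall>i\<in>{1..n}. Q i \<in> St}"
    then obtain Q where Q: "\<And>i. i \<in> {1..n} \<Longrightarrow> Q i \<in> convex hull S" "x = root n (rho (mat_prod Q n))"
      using assms(4) by blast
    have "root n (a ^ n) \<le> x"
      using that min[OF Q(1)] unfolding Q(2) by (intro real_root_le_mono) auto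
    then show "a \<le> x"
      using A(2) that by (simp add: real_root_power_cancel)
  qed
  moreover have hat: "rho_hat_n n St = b" if "n \<ge> 1" for n
    unfolding rho_hat_n_def
  proof (rule cSup_eq_maximum)
    have "root n (rho (mat_prod (\<lambda>_. B) n)) = b"
      using B that by (simp add: real_root_power_cancel)
    then show "b \<in> (\<lambda>Q. root n (rho (mat_prod Q n))) ` {Q. \<forall>i\<in>{1..n}. Q i \<in> St}"
      using B(1) assms(3) by (intro rev_image_eqI[of "\<lambda>_. B"]) auto
    fix x
    assume "x \<in> (\<lambda>Q. root n (rho (mat_prod Q n))) ` {Q. \<forall>i\<in>{1..n}. Q i \<in> St}"
    then obtain Q where Q: "\<And>i. i \<in> {1..n} \<Longrightarrow> Q i \<in> convex hull S" "x = root n (rho (mat_prod Q n))"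
      using assms(4) by blast
    have "x \<le> root n (b ^ n)"
      using that max[OF Q(1)] unfolding Q(2) by (intro real_root_le_mono) auto
    then show "x \<le> b"
      using B(2) that by (simp add: real_root_power_cancel)
  qed
  moreover have "lower_spectral_radius St = a" "generalized_spectral_radius St = b"
    unfolding lower_spectral_radius_def generalized_spectral_radius_def
    using check hat by (auto intro!: cInf_eq_minimum cSup_eq_maximum)
  moreover have "a \<in> rho ` S" "b \<in> rho ` S" "a \<in> rho ` St" "b \<in> rho ` St"
    using A(1) B(1) rhoA rhoB assms(3) by blast+
  ultimately show ?thesis
    by simp
qed

end
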